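(* Let $Y$ be a real linear space and $F,D\subseteq Y$, and assume that there exists some $d\in D\setminus\{0\}$ such that $td\in D\setminus\{0\}$ for all $t\in(0,1)$. Then $\operatorname{Eff}(F,D)\subseteq F\setminus\operatorname{core}F$.
   Context: $\operatorname{Eff}(F,D):=\{y^0\in F\mid F\cap(y^0-D)\subseteq\{y^0\}\}$. $\operatorname{core}F$ denotes the algebraic interior of $F$. *)

theory Defs
  imports Complex_Main
begin

text \<open>The efficient points of \<open>F\<close> with respect to an arbitrary domination set \<open>D\<close>;
  the image is \<open>y0 - D\<close>.\<close>

definition Eff :: "'a::real_vector set \<Rightarrow> 'a set \<Rightarrow> 'a set" where
  "Eff F D = {y0 \<in> F. F \<inter> (\<lambda>d. y0 - d) ` D \<subseteq> {y0}}"

text \<open>The algebraic interior, relative to the whole space; no topology is involved.\<close>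

definition core :: "'a::real_vector set \<Rightarrow> 'a set" where
  "core F = {y \<in> F. \<forall>v. \<exists>\<epsilon>>0. \<forall>t\<in>{0..\<epsilon>}. y + t *\<^sub>R v \<in> F}"

end

theory Submission
  imports Defs
begin

text \<open>A core point \<open>y\<close> of \<open>F\<close> can be moved a little in the direction \<open>- d\<close> without leaving \<open>F\<close>.
  Since short multiples of \<open>d\<close> are nonzero elements of \<open>D\<close>, the point reached lies in
  \<open>F \<inter> (y - D)\<close> and differs from \<open>y\<close>, so \<open>y\<close> is not efficient.\<close>

theorem proposition5:
  fixes F D :: "'a::real_vector set"
  assumes "\<exists>d \<in> D - {0}. \<forall>t::real. 0 < t \<and> t < 1 \<longrightarrow> t *\<^sub>R d \<in> D - {0}"
  shows "Eff F D \<subseteq> F - core F"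
proof
  fix y assume "y \<in> Eff F D"
  then have "y \<in> F" and eff: "F \<inter> (\<lambda>d. y - d) ` D \<subseteq> {y}"
    by (auto simp: Eff_def)
  obtain d where d: "\<And>t::real. 0 < t \<Longrightarrow> t < 1 \<Longrightarrow> t *\<^sub>R d \<in> D - {0}"
    using assms by blast
  have "y \<notin> core F"
  proof
    assume "y \<in> core F"
    then obtain \<epsilon> :: real where "\<epsilon> > 0" and \<epsilon>: "\<forall>t\<in>{0..\<epsilon>}. y + t *\<^sub>R (- d) \<in> F"
      unfolding core_def by blast
    define t where "t = min \<epsilon> (1/2)"
    have t: "0 < t" "t < 1" "t \<in> {0..\<epsilon>}"
      using \<open>\<epsilon> > 0\<close> by (auto simp: t_def)
    have "y - t *\<^sub>R d \<in> F"
      using \<epsilon> t(3) by fastforce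
    moreover have "t *\<^sub>R d \<in> D" "t *\<^sub>R d \<noteq> 0"
      using d[OF t(1,2)] by auto
    ultimately have "y - t *\<^sub>R d = y"
      using eff by blast
    with \<open>t *\<^sub>R d \<noteq> 0\<close> show False by simp
  qed
  with \<open>y \<in> F\<close> show "y \<in> F - core F" by blast
qed

end
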